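(* Let $k \geq 4$ and let $A = \{a_0, a_1, \ldots, a_{k-1}\}$ be a set of $k$ nonnegative integers with $0 = a_0 < a_1 < \cdots < a_{k-1}$ and $d(A) = 1$. Then \[ |S(A)| \geq \begin{cases} a_{k-1} + \dfrac{(k-1)(k-2)}{2} + 1 & \text{if } a_{k-1} \leq 2k-5,\\[2mm] \theta k - 3 + \dfrac{(k-1)(k-2)}{2} & \text{if } a_{k-1} \geq 2k-4. \end{cases} \]
   Context: For a nonempty finite set $A$ of integers, $S(A) = \{\sum_{b\in B} b : \emptyset \neq B \subseteq A\}$ is the set of all nonempty subset sums of $A$. $d(A)$ denotes the greatest common divisor of the elements of $A$. $\theta = \frac{1+\sqrt{5}}{2}$ is the golden mean. *)

theory Defs
  imports Complex_Main
begin

definition subset_sums :: "int set \<Rightarrow> int set" where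
  "subset_sums A = {(\<Sum>b\<in>B. b) | B. B \<noteq> {} \<and> B \<subseteq> A}"

definition golden_mean :: real where
  "golden_mean = (1 + sqrt 5) / 2"

end

theory Submission
  imports Defs
begin

text \<open>Let \<open>B\<close> be the set of the \<open>n = k - 1\<close> positive elements of \<open>A\<close>, \<open>m\<close> its maximum and
  \<open>C = B - {m}\<close>. The subset sums of \<open>B\<close> outnumber those of \<open>C\<close> by at least the number of residue
  classes modulo \<open>m\<close> that the sums of \<open>C\<close> meet. If \<open>m \<le> 2 n - 3\<close>, every residue is a sum of two
  distinct elements of \<open>C \<union> {0}\<close> by pigeonhole, which gives the first bound.

  If \<open>m \<ge> 2 n - 2\<close>, induction on \<open>n\<close> gives the stronger bound \<open>n (n - 1) / 2 + 2 n - 2\<close>. With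
  \<open>p = max C\<close>: if \<open>p \<le> 2 n - 5\<close>, the sums of \<open>C\<close> contain all of \<open>[p, 2 p)\<close>; if \<open>gcd C > 1\<close>, the
  sums with and without \<open>m\<close> are disjoint; otherwise the induction hypothesis applies to \<open>C\<close>, and it
  suffices that some sum of \<open>C\<close> is not congruent to an element of \<open>C \<union> {0}\<close>.\<close>

section \<open>Subset sums with the empty sum included\<close>

text \<open>Unlike \<open>subset_sums\<close>, this admits the empty sum.\<close>

definition sums0 :: "int set \<Rightarrow> int set" where
  "sums0 B = \<Sum> ` Pow B"

lemma finite_sums0 [simp]: "finite B \<Longrightarrow> finite (sums0 B)"
  by (simp add: sums0_def)

lemma sums0_memI: "C \<subseteq> B \<Longrightarrow> \<Sum>C \<in> sums0 B"
  by (auto simp: sums0_def)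

lemma zero_in_sums0 [simp]: "0 \<in> sums0 B"
  using sums0_memI[of "{}" B] by simp

lemma elem_in_sums0: "x \<in> B \<Longrightarrow> x \<in> sums0 B"
  using sums0_memI[of "{x}" B] by simp

lemma pair_in_sums0:
  assumes "x \<in> insert 0 B" "y \<in> insert 0 B" "x \<noteq> y"
  shows "x + y \<in> sums0 B"
proof (cases "x = 0 \<or> y = 0")
  case True
  then show ?thesis using assms elem_in_sums0 by auto
next
  case False
  then show ?thesis using assms sums0_memI[of "{x, y}" B] by auto
qed

lemma sums0_insert:
  assumes "finite B" "m \<notin> B"
  shows "sums0 (insert m B) = sums0 B \<union> (+) m ` sums0 B"
proof -
  have "\<Sum> (insert m C) = m + \<Sum>C" if "C \<in> Pow B" for C
    using that assms finite_subset by (subst sum.insert) auto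
  then have "\<Sum> ` insert m ` Pow B = (+) m ` \<Sum> ` Pow B"
    by (simp add: image_image)
  then show ?thesis
    by (simp add: sums0_def Pow_insert image_Un)
qed

lemma subset_sums_insert_zero:
  assumes "finite B" "0 \<notin> B"
  shows "subset_sums (insert 0 B) = sums0 B"
proof
  show "subset_sums (insert 0 B) \<subseteq> sums0 B"
  proof
    fix x assume "x \<in> subset_sums (insert 0 B)"
    then obtain C where C: "C \<subseteq> insert 0 B" "x = \<Sum>C"
      by (auto simp: subset_sums_def)
    then have "x = \<Sum>(C - {0})" "C - {0} \<subseteq> B"
      using assms(1) finite_subset[OF C(1)]
      by (auto simp: sum_diff1)
    then show "x \<in> sums0 B" by (simp add: sums0_memI)
  qed
next
  show "sums0 B \<subseteq> subset_sums (insert 0 B)"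
  proof
    fix x assume "x \<in> sums0 B"
    then obtain C where C: "C \<subseteq> B" "x = \<Sum>C" by (auto simp: sums0_def)
    have "finite C" "0 \<notin> C" using C assms finite_subset by auto
    then have "x = \<Sum>(insert 0 C)" using C(2) by simp
    moreover have "insert 0 C \<subseteq> insert 0 B" using C(1) by blast
    ultimately show "x \<in> subset_sums (insert 0 B)"
      unfolding subset_sums_def by blast
  qed
qed

section \<open>Counting new sums through residues modulo the maximum\<close>

text \<open>In each residue class met by \<open>sums0 B\<close>, the largest element shifted by \<open>m\<close> is new.\<close>

lemma card_sums0_insert:
  fixes m :: int
  assumes "finite B" "m \<notin> B" "m > 0"
  shows "card (sums0 (insert m B)) \<ge> card (sums0 B) + card ((\<lambda>x. x mod m) ` sums0 B)"
proof -
  let ?F = "sums0 B"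
  let ?R = "(\<lambda>x. x mod m) ` ?F"
  define top where "top r = Max {x \<in> ?F. x mod m = r}" for r
  have fin: "finite ?F" using assms(1) by simp
  have top_in: "top r \<in> ?F \<and> top r mod m = r" if "r \<in> ?R" for r
  proof -
    have "{x \<in> ?F. x mod m = r} \<noteq> {}" using that by auto
    then have "top r \<in> {x \<in> ?F. x mod m = r}"
      unfolding top_def using fin by (intro Max_in) auto
    then show ?thesis by simp
  qed
  have top_ge: "x \<le> top (x mod m)" if "x \<in> ?F" for x
    unfolding top_def using that fin by (intro Max_ge) auto
  let ?T = "(\<lambda>r. m + top r) ` ?R"
  have "inj_on (\<lambda>r. m + top r) ?R"
    by (rule inj_onI) (metis top_in add_left_cancel)
  then have "card ?T = card ?R" by (rule card_image)
  moreover have "?F \<inter> ?T = {}"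
  proof -
    have "m + top r \<notin> ?F" if "r \<in> ?R" for r
    proof
      assume "m + top r \<in> ?F"
      from top_ge[OF this] top_in[OF that] assms(3) show False by simp
    qed
    then show ?thesis by blast
  qed
  moreover have "?F \<union> ?T \<subseteq> sums0 (insert m B)"
    unfolding sums0_insert[OF assms(1,2)] using top_in by auto
  then have "card (?F \<union> ?T) \<le> card (sums0 (insert m B))"
    using assms(1) by (intro card_mono) auto
  ultimately show ?thesis using fin by (simp add: card_Un_disjoint)
qed

lemma card_le_residues:
  assumes "finite B" "X \<subseteq> sums0 B" "X \<subseteq> {0..<m}"
  shows "card X \<le> card ((\<lambda>x. x mod m) ` sums0 B)"
proof -
  have "x mod m = x" if "x \<in> X" for x using that assms(3) by (auto intro: mod_pos_pos_trivial)
  then have "X \<subseteq> (\<lambda>x. x mod m) ` sums0 B"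
    using assms(2) by force
  then show ?thesis using assms(1) by (intro card_mono) auto
qed

text \<open>Build \<open>B\<close> in increasing order: modulo a new maximum \<open>m\<close>, the
  number 0 and the smaller elements are distinct residues, so each step gains at least
  \<open>card B + 1\<close> sums.\<close>

lemma card_sums0_ge:
  assumes "finite B" "\<forall>x\<in>B. 0 < x"
  shows "2 * card (sums0 B) \<ge> card B * (card B + 1) + 2"
  using assms
proof (induction B rule: finite_linorder_max_induct)
  case empty
  then show ?case by (simp add: sums0_def)
next
  case (insert m B)
  have "card (insert 0 B) \<le> card ((\<lambda>x. x mod m) ` sums0 B)"
    using insert by (intro card_le_residues) (auto simp: elem_in_sums0 less_imp_le)
  moreover have "card (insert 0 B) = card B + 1" using insert by auto
  moreover have "m \<notin> B" using insert by auto
  moreover have "card (sums0 (insert m B)) \<ge> card (sums0 B) + card ((\<lambda>x. x mod m) ` sums0 B)"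
    using insert \<open>m \<notin> B\<close> by (intro card_sums0_insert) auto
  moreover have "2 * card (sums0 B) \<ge> card B * (card B + 1) + 2"
    using insert by auto
  ultimately show ?case using insert.hyps(1) by simp
qed

section \<open>Dense sets: pair sums cover all residues\<close>

text \<open>There are at least \<open>2 |X| - m \<ge> 3\<close> ordered representations of \<open>r\<close>, while \<open>2 x \<equiv> r\<close>
  has at most two solutions modulo \<open>m\<close>.\<close>

lemma sum_of_two_distinct_mod:
  fixes m r :: int
  assumes X: "X \<subseteq> {0..<m}" and card: "2 * int (card X) \<ge> m + 3" and r: "0 \<le> r" "r < m"
  shows "\<exists>x\<in>X. \<exists>y\<in>X. x \<noteq> y \<and> (x + y) mod m = r"
proof (rule ccontr)
  assume no: "\<not> ?thesis"
  \<comment> \<open>\<open>f x\<close> is the partner completing \<open>x\<close> to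
    \<open>r\<close> modulo \<open>m\<close>. Under \<open>no\<close>, a partner lying in
    \<open>X\<close> must be \<open>x\<close> itself, so \<open>X\<close> and its image share at
    most two points. Their union then has at least \<open>2 * card X - 2 > m\<close> elements inside
    \<open>{0..<m}\<close>.\<close>
  define f where "f x = (r - x) mod m" for x
  have fin: "finite X" using X finite_subset by blast
  have "inj_on f X"
  proof (rule inj_onI)
    fix x y assume xy: "x \<in> X" "y \<in> X" "f x = f y"
    have "(r - (r - x)) mod m = (r - (r - y)) mod m"
      using xy(3) unfolding f_def by (rule mod_diff_cong[OF refl])
    moreover have "0 \<le> x" "x < m" "0 \<le> y" "y < m" using xy(1,2) X by auto
    ultimately show "x = y" by simp
  qed
  then have cf: "card (f ` X) = card X" by (rule card_image)
  have "f ` X \<inter> X \<subseteq> {r div 2, (r + m) div 2}"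
  proof
    fix y assume y: "y \<in> f ` X \<inter> X"
    then obtain x where x: "x \<in> X" "y = f x" by auto
    have "(x + y) mod m = (x + (r - x)) mod m"
      unfolding x(2) f_def by (simp add: mod_add_right_eq)
    then have s: "(x + y) mod m = r" using r by simp
    then have "x = y" using no x(1) y by blast
    have b: "0 \<le> y" "y < m" using y X by auto
    show "y \<in> {r div 2, (r + m) div 2}"
    proof (cases "2 * y < m")
      case True
      then have "2 * y = r" using s \<open>x = y\<close> b by simp
      then show ?thesis by auto
    next
      case False
      have "(2 * y - m) mod m = r" using s \<open>x = y\<close> by simp
      moreover have "(2 * y - m) mod m = 2 * y - m"
        using False b by (intro mod_pos_pos_trivial) auto
      ultimately have "2 * y = r + m" by simp
      then show ?thesis by auto
    qed
  qed
  then have "card (f ` X \<inter> X) \<le> card {r div 2, (r + m) div 2}"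
    by (intro card_mono) auto
  also have "\<dots> \<le> 2" by (simp add: card_insert_if)
  finally have "card (f ` X \<inter> X) \<le> 2" .
  moreover have "card (f ` X \<union> X) \<le> card {0..<m}"
    using X r by (intro card_mono) (auto simp: f_def)
  moreover have "card (f ` X) + card X = card (f ` X \<union> X) + card (f ` X \<inter> X)"
    using fin by (intro card_Un_Int) auto
  ultimately show False using card cf r by simp
qed

lemma card_sums0_insert_dense:
  fixes m :: int
  assumes B: "B \<subseteq> {0<..<m}" and m: "m > 0" and dense: "m + 1 \<le> 2 * int (card B)"
  shows "2 * int (card (sums0 (insert m B))) \<ge> 2 * m + int (card B) * (int (card B) + 1) + 2"
proof -
  have fin: "finite B" using B finite_subset by blast
  have cX: "card (insert 0 B) = card B + 1" using fin B by (force simp: card_insert_if)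
  have X: "insert 0 B \<subseteq> {0..<m}" using B m by auto
  have "{0..<m} \<subseteq> (\<lambda>x. x mod m) ` sums0 B"
  proof
    fix r assume r: "r \<in> {0..<m}"
    \<comment> \<open>Adjoining 0 adds one element, which turns \<open>m + 1\<close> in
      \<open>dense\<close> into the required \<open>m + 3\<close>.\<close>
    have "2 * int (card (insert 0 B)) \<ge> m + 3" using cX dense by simp
    then obtain x y where "x \<in> insert 0 B" "y \<in> insert 0 B" "x \<noteq> y" "(x + y) mod m = r"
      using sum_of_two_distinct_mod[OF X, of r] r by (meson atLeastLessThan_iff)
    then show "r \<in> (\<lambda>x. x mod m) ` sums0 B" using pair_in_sums0 by blast
  qed
  then have "card {0..<m} \<le> card ((\<lambda>x. x mod m) ` sums0 B)"
    using fin by (intro card_mono) auto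
  moreover have "card (sums0 (insert m B)) \<ge> card (sums0 B) + card ((\<lambda>x. x mod m) ` sums0 B)"
    using fin B m by (intro card_sums0_insert) auto
  moreover have "int (card B * (card B + 1) + 2) \<le> int (2 * card (sums0 B))"
    using fin B by (intro of_nat_mono card_sums0_ge) auto
  then have "int (card B) * (int (card B) + 1) + 2 \<le> 2 * int (card (sums0 B))"
    by (simp only: of_nat_mult of_nat_add of_nat_1 of_nat_numeral)
  ultimately show ?thesis using m by simp
qed

text \<open>Some pair sum from \<open>insert 0 B\<close> is congruent to \<open>t - p\<close> modulo
  \<open>p\<close> and lies below \<open>2 * p\<close>. It is therefore \<open>t\<close> itself or
  \<open>t - p\<close>, and in the latter case adding \<open>p\<close> gives
  \<open>t\<close>.\<close>

lemma interval_subset_sums0_dense: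
  fixes p :: int
  assumes B: "B \<subseteq> {0<..<p}" and dense: "p + 1 \<le> 2 * int (card B)"
  shows "{p..<2 * p} \<subseteq> sums0 (insert p B)"
proof
  fix t assume t: "t \<in> {p..<2 * p}"
  have fin: "finite B" using B finite_subset by blast
  have "p \<notin> B" using B by auto
  have cX: "card (insert 0 B) = card B + 1" using fin B by (force simp: card_insert_if)
  have X: "insert 0 B \<subseteq> {0..<p}" using B t by auto
  have "2 * int (card (insert 0 B)) \<ge> p + 3" "0 \<le> t - p" "t - p < p"
    using cX dense t by auto
  then obtain x y where xy: "x \<in> insert 0 B" "y \<in> insert 0 B" "x \<noteq> y" "(x + y) mod p = t - p"
    using sum_of_two_distinct_mod[OF X, of "t - p"] by blast
  have s: "x + y \<in> sums0 B" using xy pair_in_sums0 by blast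
  have b: "0 \<le> x + y" "x + y < 2 * p" using subsetD[OF X xy(1)] subsetD[OF X xy(2)] by auto
  have "x + y = t - p \<or> x + y = t"
  proof (cases "x + y < p")
    case True
    then show ?thesis using xy(4) b by simp
  next
    case False
    have "(x + y - p) mod p = t - p" using xy(4) by simp
    moreover have "(x + y - p) mod p = x + y - p"
      using False b by (intro mod_pos_pos_trivial) auto
    ultimately show ?thesis by simp
  qed
  then have "t = x + y \<or> t = p + (x + y)" by auto
  then show "t \<in> sums0 (insert p B)"
    using s by (auto simp: sums0_insert[OF fin \<open>p \<notin> B\<close>])
qed

section \<open>Sparse sets: one extra residue, then induction\<close>

text \<open>If \<open>insert 0 B\<close> were closed under sums of distinct elements modulo \<open>m\<close>, adding the largest
  element \<open>p = m - q\<close> would act on the other elements as subtraction of \<open>q\<close>; this forces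
  \<open>B = {q, 2 q, \<dots>, p}\<close>.\<close>

lemma new_residue:
  fixes m :: int
  assumes B: "B \<subseteq> {0<..<m}" and s: "card B \<ge> 3" and gcd: "Gcd (insert m B) = 1"
    and m: "m \<ge> int (card B) + 2"
  shows "\<exists>x\<in>sums0 B. x mod m \<notin> insert 0 B"
proof (rule ccontr)
  assume "\<not> ?thesis"
  then have closed: "(x + y) mod m \<in> insert 0 B" if "x \<in> B" "y \<in> B" "x \<noteq> y" for x y
    using that pair_in_sums0 by blast
  have fin: "finite B" using B finite_subset by blast
  define p where "p = Max B"
  define C where "C = B - {p}"
  define q where "q = m - p"
  have "B \<noteq> {}" using s by auto
  then have p: "p \<in> B" "\<And>x. x \<in> B \<Longrightarrow> x \<le> p" using fin by (auto simp: p_def)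
  have q: "q > 0" using p(1) B by (auto simp: q_def)
  have finC: "finite C" using fin by (simp add: C_def)
  have cC: "card B = card C + 1" using fin p(1) s by (simp add: C_def)
  have C: "0 < b" "b < p" "b \<in> B" if "b \<in> C" for b
    using that B p(2)[of b] by (auto simp: C_def)
  \<comment> \<open>Modulo \<open>m\<close>, adding \<open>p\<close> subtracts \<open>q\<close>. If
    \<open>p + b\<close> stayed below \<open>m\<close>, closure would give an element of
    \<open>B\<close> above its maximum \<open>p\<close>.\<close>
  have step: "b = q \<or> b - q \<in> C" if b: "b \<in> C" for b
  proof -
    have m0: "(p + b) mod m \<in> insert 0 B" using closed[of p b] p(1) C[OF b] by auto
    have "p < m" using p(1) B by auto
    have "p + b \<ge> m"
    proof (rule ccontr)
      assume "\<not> p + b \<ge> m"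
      then have "(p + b) mod m = p + b" using C[OF b] by (intro mod_pos_pos_trivial) auto
      then show False using m0 p(2)[of "p + b"] C[OF b] by auto
    qed
    moreover have "(p + b) mod m = (p + b - m) mod m" by simp
    moreover have "(p + b - m) mod m = p + b - m"
      using \<open>p + b \<ge> m\<close> C[OF b] \<open>p < m\<close> by (intro mod_pos_pos_trivial) auto
    ultimately have "p + b - m \<in> insert 0 B" using m0 by metis
    moreover have "p + b - m = b - q" by (simp add: q_def)
    ultimately have "b - q \<in> insert 0 B" by metis
    then show ?thesis using C[OF b] q by (auto simp: C_def)
  qed
  have "C \<noteq> {}" using cC s by auto
  define c where "c = Max C"
  have c: "c \<in> C" "\<And>x. x \<in> C \<Longrightarrow> x \<le> c" using finC \<open>C \<noteq> {}\<close> by (auto simp: c_def)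
  have "Min C \<in> C" using finC \<open>C \<noteq> {}\<close> by simp
  moreover have "Min C - q \<notin> C" using Min_le[OF finC, of "Min C - q"] q by auto
  ultimately have "Min C = q" "q \<in> C" using step[of "Min C"] by auto
  have "q \<noteq> c"
  proof
    assume "q = c"
    then have "x = c" if "x \<in> C" for x
      using Min_le[OF finC that] c(2)[OF that] \<open>Min C = q\<close> by simp
    then have "C \<subseteq> {c}" by blast
    then have "card C \<le> 1" using card_mono[of "{c}" C] by simp
    then show False using cC s by simp
  qed
  \<comment> \<open>Closure applies to the distinct elements \<open>q\<close> and \<open>c\<close>.
    Their sum is below \<open>m\<close> and exceeds the maximum of \<open>C\<close>, so it can only
    be \<open>p\<close>.\<close>
  have "q + c < m" using C(2)[OF c(1)] by (simp add: q_def)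
  then have "(q + c) mod m = q + c" using q C(1)[OF c(1)] by (intro mod_pos_pos_trivial) auto
  then have "q + c \<in> insert 0 B" using closed[of q c] \<open>q \<noteq> c\<close> \<open>q \<in> C\<close> c(1) C(3) by metis
  then have "q + c \<in> B" using q C(1)[OF c(1)] by auto
  moreover have "q + c \<notin> C" using c(2)[of "q + c"] q by auto
  ultimately have pc: "p = q + c" by (auto simp: C_def)
  \<comment> \<open>Descending from \<open>b\<close> in steps of \<open>q\<close> stays in
    \<open>C\<close> until it reaches \<open>q\<close>.\<close>
  have dvdC: "b \<in> C \<Longrightarrow> q dvd b" for b
  proof (induction "nat b" arbitrary: b rule: less_induct)
    case less
    show ?case
    proof (cases "b = q")
      case False
      then have "b - q \<in> C" using step less.prems by blast
      moreover from this have "q dvd b - q"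
        using less.hyps[of "b - q"] C(1)[of "b - q"] q by auto
      ultimately show ?thesis by (metis diff_add_cancel dvd_add dvd_refl)
    qed simp
  qed
  have "q dvd x" if x: "x \<in> insert m B" for x
  proof -
    have "q dvd c" by (rule dvdC[OF c(1)])
    moreover have "m = q + q + c" using pc by (simp add: q_def)
    moreover have "x = m \<or> x = p \<or> x \<in> C" using x by (auto simp: C_def)
    ultimately show ?thesis using dvdC pc by auto
  qed
  then have "q dvd Gcd (insert m B)" by (intro Gcd_greatest)
  then have q1: "q = 1" using q unfolding gcd by simp
  \<comment> \<open>With \<open>q = 1\<close> the descent from \<open>c\<close> fills
    \<open>{1..c}\<close>. Hence \<open>c \<le> card C\<close>, so \<open>m = c + 2\<close> is at
    most \<open>card B + 1\<close>, against the bound on \<open>m\<close>.\<close>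
  have down: "int j < c \<Longrightarrow> c - int j \<in> C" for j
  proof (induction j)
    case (Suc j)
    then have "c - int j \<in> C" by simp
    then show ?case using step[of "c - int j"] Suc.prems q1 by (auto simp: algebra_simps)
  qed (simp add: c(1))
  have "{1..c} \<subseteq> C"
  proof
    fix x assume "x \<in> {1..c}"
    then show "x \<in> C" using down[of "nat (c - x)"] by auto
  qed
  then have "card {1..c} \<le> card C" using finC by (rule card_mono[rotated])
  then show False using m cC pc q1 by (simp add: q_def)
qed

text \<open>From \<open>n - 1\<close> to \<open>n\<close> the doubled bound grows by
  \<open>2 * n + 2\<close>, so an inductive step must gain \<open>n + 1\<close> residues: one more
  than 0 and the \<open>n - 1\<close> smaller elements supply.\<close>

lemma card_sums0_sparse:
  assumes "finite B" "\<forall>x\<in>B. 0 < x" "Gcd B = 1" "card B = n" "n \<ge> 3" "Max B \<ge> 2 * int n - 2"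
  shows "2 * int (card (sums0 B)) \<ge> int n * int n + 3 * int n - 4"
  using assms
proof (induction n arbitrary: B rule: less_induct)
  case (less n)
  note fin = less.prems(1) and pos = less.prems(2) and gcd = less.prems(3)
    and n = less.prems(4) and n3 = less.prems(5) and mx = less.prems(6)
  show ?case
  proof (cases "n = 3")
    \<comment> \<open>For \<open>n = 3\<close> the general quadratic bound and the claimed one
      agree: both sides give 14.\<close>
    case True
    then show ?thesis using card_sums0_ge[OF fin pos] n by simp
  next
    case False
    with n3 have n4: "n \<ge> 4" by simp
    define m where "m = Max B"
    define C where "C = B - {m}"
    have mB: "m \<in> B" using fin n n3 unfolding m_def by (intro Max_in) auto
    have Bm: "B = insert m C" using mB by (auto simp: C_def)
    have C: "C \<subseteq> {0<..<m}"
      using Max_ge[OF fin] pos by (force simp: C_def m_def)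
    have finC: "finite C" and mC: "m \<notin> C" and cC: "int (card C) = int n - 1"
      using fin mB n n3 by (auto simp: C_def of_nat_diff)
    have m0: "m > 0" using mB pos by auto
    have Cne: "C \<noteq> {}" using cC n4 by auto
    define p where "p = Max C"
    define D where "D = C - {p}"
    have pC: "p \<in> C" using finC Cne by (simp add: p_def)
    have Cp: "C = insert p D" using pC by (auto simp: D_def)
    have D: "D \<subseteq> {0<..<p}"
      using Max_ge[OF finC] C by (force simp: D_def p_def)
    have finD: "finite D" and cD: "int (card D) = int n - 2"
    proof -
      show "finite D" using finC by (simp add: D_def)
      then have "card C = card D + 1" using Cp D by (force simp: card_insert_if)
      then show "int (card D) = int n - 2" using cC by simp
    qed
    have pm: "0 < p" "p < m" using pC C by auto
    let ?R = "(\<lambda>x. x mod m) ` sums0 C"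
    have grow: "card (sums0 B) \<ge> card (sums0 C) + card ?R"
      unfolding Bm using finC mC m0 by (rule card_sums0_insert)
    have posC: "\<forall>x\<in>C. 0 < x" using C by auto
    consider "p \<le> 2 * int n - 5" | "Gcd C \<noteq> 1" | "p \<ge> 2 * int n - 4" "Gcd C = 1" by linarith
    then show ?thesis
    proof cases
      case 1
      then have dense: "p + 1 \<le> 2 * int (card D)" using cD by simp
      have c1: "2 * int (card (sums0 C)) \<ge> 2 * p + int (card D) * (int (card D) + 1) + 2"
        using card_sums0_insert_dense[OF D pm(1) dense] unfolding Cp .
      \<comment> \<open>Cutting at \<open>m\<close> keeps the interval inside one period. In the
        final count the \<open>2 * p\<close> of \<open>c1\<close> cancels the loss from
        \<open>?t - p\<close>, so only \<open>?t \<ge> 2 * n - 2\<close> matters.\<close>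
      let ?t = "min m (2 * p)"
      have "insert 0 D \<subseteq> sums0 C" using Cp by (auto simp: elem_in_sums0)
      moreover have "{p..<?t} \<subseteq> sums0 C"
        using interval_subset_sums0_dense[OF D dense] unfolding Cp by auto
      ultimately have "{p..<?t} \<union> insert 0 D \<subseteq> sums0 C" by blast
      moreover have "{p..<?t} \<union> insert 0 D \<subseteq> {0..<m}" using D pm by auto
      ultimately have "card ({p..<?t} \<union> insert 0 D) \<le> card ?R"
        using finC by (intro card_le_residues)
      moreover have "card ({p..<?t} \<union> insert 0 D) = card {p..<?t} + card (insert 0 D)"
        using D finD pm by (intro card_Un_disjoint) auto
      moreover have "card (insert 0 D) = card D + 1" using D finD by (force simp: card_insert_if)
      ultimately have c2: "int (card ?R) \<ge> ?t - p + int (card D) + 1" using pm by simp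
      have "card D \<le> card {0<..<p}" using D by (intro card_mono) auto
      then have "p \<ge> int n - 1" using cD pm by simp
      then have t: "?t \<ge> 2 * int n - 2" using mx by (simp add: m_def)
      have "2 * int (card (sums0 B)) \<ge> 2 * int (card (sums0 C)) + 2 * int (card ?R)"
        using grow by linarith
      moreover have "int (card D) * (int (card D) + 1) = int n * int n - 3 * int n + 2"
        unfolding cD by (simp add: algebra_simps)
      ultimately show ?thesis using c1 c2 t cD by linarith
    next
      case 2
      have dvd: "Gcd C dvd x" if "x \<in> sums0 C" for x
      proof -
        obtain E where "E \<subseteq> C" "x = \<Sum>E" using \<open>x \<in> sums0 C\<close> by (auto simp: sums0_def)
        then show ?thesis by (auto intro!: dvd_sum)
      qed
      have "sums0 C \<inter> (+) m ` sums0 C = {}"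
      proof (rule ccontr)
        assume "sums0 C \<inter> (+) m ` sums0 C \<noteq> {}"
        then obtain x where "x \<in> sums0 C" "m + x \<in> sums0 C" by auto
        then have "Gcd C dvd m" using dvd by (metis dvd_add_left_iff)
        then have "Gcd C dvd Gcd B" unfolding Bm by simp
        then show False using gcd 2 by simp
      qed
      then have "card (sums0 B) = card (sums0 C) + card ((+) m ` sums0 C)"
        unfolding Bm sums0_insert[OF finC mC] using finC by (intro card_Un_disjoint) auto
      then have "card (sums0 B) = 2 * card (sums0 C)" by (simp add: card_image)
      moreover have "int (2 * card (sums0 C)) \<ge> int (card C * (card C + 1) + 2)"
        using card_sums0_ge[OF finC posC] by (intro of_nat_mono)
      then have "2 * int (card (sums0 C)) \<ge> int n * int n - int n + 2"
        using cC by (simp add: algebra_simps)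
      \<comment> \<open>Twice the quadratic bound for \<open>C\<close> has leading term
        \<open>2 * n * n\<close>; this inequality, valid from \<open>n = 4\<close> on, absorbs the
        linear deficit.\<close>
      moreover have "0 \<le> (int n - 1) * (int n - 4)" using n4 by simp
      then have "int n * int n \<ge> 5 * int n - 4" by (simp add: algebra_simps)
      ultimately show ?thesis by linarith
    next
      case 3
      \<comment> \<open>The case condition \<open>p \<ge> 2 * n - 4\<close> is exactly the sparsity
        hypothesis for \<open>n - 1\<close>.\<close>
      have "2 * int (card (sums0 C)) \<ge> int (n - 1) * int (n - 1) + 3 * int (n - 1) - 4"
        using 3 n4 cC finC posC by (intro less.IH) (auto simp: p_def of_nat_diff)
      then have c1: "2 * int (card (sums0 C)) \<ge> int n * int n + int n - 6"
        using n4 by (simp add: of_nat_diff algebra_simps)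
      obtain x where x: "x \<in> sums0 C" "x mod m \<notin> insert 0 C"
        using new_residue[OF C] gcd cC n4 mx unfolding Bm[symmetric] m_def[symmetric] by auto
      have "y \<in> ?R" if "y \<in> insert 0 C" for y
      proof -
        have "y mod m = y" using that C m0 by (auto intro: mod_pos_pos_trivial)
        moreover have "y \<in> sums0 C" using that elem_in_sums0 by auto
        ultimately show ?thesis by force
      qed
      then have "insert (x mod m) (insert 0 C) \<subseteq> ?R" using x(1) by blast
      then have "card (insert (x mod m) (insert 0 C)) \<le> card ?R"
        using finC by (intro card_mono) auto
      moreover have "0 \<notin> C" using C by auto
      then have "card (insert (x mod m) (insert 0 C)) = card C + 2"
        using x(2) finC by simp
      ultimately have "int (card ?R) \<ge> int n + 1" using cC by linarith
      then show ?thesis using c1 grow by linarith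
    qed
  qed
qed

section \<open>Both bounds in terms of \<open>k\<close>\<close>

theorem theorem3p3:
  fixes k :: nat and a :: "nat \<Rightarrow> int" and A :: "int set"
  assumes "k \<ge> 4"
    and "A = a ` {0..k - 1}"
    and "a 0 = 0"
    and "strict_mono_on {0..k - 1} a"
    and "Gcd A = 1"
  shows "(a (k - 1) \<le> 2 * int k - 5 \<longrightarrow>
            real (card (subset_sums A)) \<ge>
              real_of_int (a (k - 1)) + (real k - 1) * (real k - 2) / 2 + 1) \<and>
         (a (k - 1) \<ge> 2 * int k - 4 \<longrightarrow>
            real (card (subset_sums A)) \<ge>
              golden_mean * real k - 3 + (real k - 1) * (real k - 2) / 2)"
proof -
  define m where "m = a (k - 1)"
  define C where "C = a ` {1..<k - 1}"
  have lt: "a i < a j" if "i < j" "j \<le> k - 1" for i j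
    using strict_mono_onD[OF assms(4), of i j] that by auto
  have "{0..k - 1} = insert 0 (insert (k - 1) {1..<k - 1})" using assms(1) by auto
  then have A: "A = insert 0 (insert m C)"
    unfolding assms(2) m_def C_def by (simp only: image_insert assms(3))
  have C: "C \<subseteq> {0<..<m}"
    using lt[of 0] lt[of _ "k - 1"] assms(3) by (auto simp: C_def m_def)
  have fin: "finite C" by (simp add: C_def)
  have "inj_on a {1..<k - 1}"
    using assms(4) by (intro strict_mono_on_imp_inj_on) (auto simp: strict_mono_on_def)
  then have cC: "int (card C) = int k - 2"
    using assms(1) by (simp add: C_def card_image of_nat_diff)
  have m0: "m > 0" using lt[of 0 "k - 1"] assms(1,3) by (simp add: m_def)
  have S: "subset_sums A = sums0 (insert m C)"
    unfolding A using fin C m0 by (intro subset_sums_insert_zero) auto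
  have "real_of_int m + (real k - 1) * (real k - 2) / 2 + 1 \<le> real (card (subset_sums A))"
    if "m \<le> 2 * int k - 5"
  proof -
    \<comment> \<open>Since \<open>card C = k - 2\<close>, the density condition
      \<open>m + 1 \<le> 2 * card C\<close> reads \<open>m \<le> 2 * k - 5\<close>.\<close>
    have "2 * int (card (sums0 (insert m C))) \<ge> 2 * m + int (card C) * (int (card C) + 1) + 2"
      using card_sums0_insert_dense[OF C m0] cC that by linarith
    moreover have "int (card C) + 1 = int k - 1" using cC by simp
    ultimately have "2 * int (card (sums0 (insert m C))) \<ge> 2 * m + (int k - 2) * (int k - 1) + 2"
      unfolding cC by simp
    then have "real_of_int (2 * int (card (sums0 (insert m C))))
        \<ge> real_of_int (2 * m + (int k - 2) * (int k - 1) + 2)"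
      by (simp only: of_int_le_iff)
    then show ?thesis unfolding S by (simp add: field_simps)
  qed
  moreover have "golden_mean * real k - 3 + (real k - 1) * (real k - 2) / 2
      \<le> real (card (subset_sums A))" if "m \<ge> 2 * int k - 4"
  proof -
    have "Max (insert m C) = m" using fin C by (intro Max_eqI) auto
    moreover have "Gcd (insert m C) = 1" using assms(5) unfolding A by simp
    moreover have "card (insert m C) = k - 1" using fin C cC by (subst card_insert_disjoint) auto
    ultimately have "2 * int (card (sums0 (insert m C)))
        \<ge> int (k - 1) * int (k - 1) + 3 * int (k - 1) - 4"
      using fin C m0 assms(1) that by (intro card_sums0_sparse) (auto simp: of_nat_diff)
    then have "2 * int (card (sums0 (insert m C))) \<ge> int k * int k + int k - 6"
      using assms(1) by (simp add: of_nat_diff algebra_simps)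
    then have "real_of_int (2 * int (card (sums0 (insert m C))))
        \<ge> real_of_int (int k * int k + int k - 6)"
      by (simp only: of_int_le_iff)
    then have "2 * real (card (subset_sums A)) \<ge> real k * real k + real k - 6"
      unfolding S by simp
    \<comment> \<open>This is precisely what remains after cancelling the quadratic terms; the crude
      estimate 7/4 for the golden mean suffices once \<open>k \<ge> 4\<close>.\<close>
    moreover have "golden_mean * real k \<le> 2 * real k - 1"
    proof -
      have "sqrt 5 \<le> 5 / 2" by (rule real_le_lsqrt) (auto simp: power2_eq_square)
      then have "golden_mean * real k \<le> 7 / 4 * real k"
        by (intro mult_right_mono) (auto simp: golden_mean_def)
      also have "\<dots> \<le> 2 * real k - 1" using assms(1) by simp
      finally show ?thesis .
    qed
    ultimately show ?thesis by (simp add: field_simps)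
  qed
  ultimately show ?thesis by (simp add: m_def)
qed

end
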